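(* Let $\mathrm{V}$ be a finite vertex set, let $\mathfrak{G}$ be the class of all acyclic directed mixed graphs (ADMGs) over $\mathrm{V}$, and let $\mathcal{L}=(\mathfrak{G},\preceq)$ be the poset with $\mathcal{G}_1\preceq\mathcal{G}_2$ if and only if $\mathcal{M}^{\mathrm{c}}_{\mathrm{ADMG}}(\mathcal{G}_1)\subseteq\mathcal{M}^{\mathrm{c}}_{\mathrm{ADMG}}(\mathcal{G}_2)$. For all $\mathcal{G}_1=(\mathrm{V},\mathrm{E}_1^{\leftrightarrow},\mathrm{E}_1^{\to})$ and $\mathcal{G}_2=(\mathrm{V},\mathrm{E}_2^{\leftrightarrow},\mathrm{E}_2^{\to})$ in $\mathfrak{G}$, $$d_{\mathcal{L}}(\mathcal{G}_1,\mathcal{G}_2)=|\mathrm{E}_1^{\leftrightarrow}\triangle\,\mathrm{E}_2^{\leftrightarrow}|+|\mathrm{E}_1^{\to}\triangle\,\mathrm{E}_2^{\to}|.$$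
   Context: An ADMG $\mathcal{G}=(\mathrm{V},\mathrm{E}^{\leftrightarrow},\mathrm{E}^{\to})$ has a set $\mathrm{E}^{\leftrightarrow}$ of bidirected edges (unordered pairs of distinct vertices) and a set $\mathrm{E}^{\to}$ of directed edges (ordered pairs of distinct vertices) with no directed cycle; a pair may carry both a bidirected and a directed edge. $\triangle$ is symmetric difference. Causal model. For each $v\in\mathrm{V}$ let $\mathcal{X}_v$ be a state space, infinite or finite with at least two elements; $\mathcal{X}_{\mathrm{I}}=\prod_{v\in\mathrm{I}}\mathcal{X}_v$ for $\mathrm{I}\subseteq\mathrm{V}$, and $\mathcal{X}=\mathcal{X}_{\mathrm{V}}$ is equipped with a suitable product $\sigma$-algebra. The potential outcome schedule is the stochastic process $X(\cdot)=(X_v(x_{\mathrm{I}}):v\in\mathrm{V},\mathrm{I}\subseteq\mathrm{V},x_{\mathrm{I}}\in\mathcal{X}_{\mathrm{I}})$, where the $\mathcal{X}_v$-valued $X_v(x_{\mathrm{I}})$ is the potential outcome of variable $v$ under the intervention imposing $x_{\mathrm{I}}$ on $X_{\mathrm{I}}$. The space in which $X(\cdot)$ takes values is assumed to carry a suitable $\sigma$-algebra; $P$ denotes the law of $X(\cdot)$ and is assumed to admit the regular conditional probability distributions used below. Write $X_{\mathrm{J}}(x_{\mathrm{I}})=(X_v(x_{\mathrm{I}}))_{v\in\mathrm{J}}$ and $X(x_{\mathrm{I}})=X_{\mathrm{V}}(x_{\mathrm{I}})$. The ground causal model $\mathcal{M}^{\mathrm{c}}$ is the set of laws $P$ satisfying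 consistency: for all disjoint $\mathrm{I},\mathrm{I}'\subseteq\mathrm{V}$ and each $x\in\mathcal{X}$, $P\big(X(x_{\mathrm{I}},x_{\mathrm{I}'})=X(x_{\mathrm{I}})\mid X_{\mathrm{I}'}(x_{\mathrm{I}})=x_{\mathrm{I}'}\big)=1$. With $\mathrm{Pa}(v)=\{w:w\to v\}$, $\mathcal{M}^{\mathrm{c}}_{\mathrm{ADMG}}(\mathcal{G})$ is the set of $P\in\mathcal{M}^{\mathrm{c}}$ such that: (i) for every $v\in\mathrm{V}$, $\mathrm{I}\subseteq\mathrm{V}$ and $x\in\mathcal{X}$, $P\big\{X_v(x_{\mathrm{I}})=X_v\big(x_{\mathrm{Pa}(v)\cap\mathrm{I}},X_{\mathrm{Pa}(v)\setminus\mathrm{I}}(x_{\mathrm{I}})\big)\big\}=1$; (ii) for all disjoint $\mathrm{A},\mathrm{B}\subset\mathrm{V}$ with no bidirected edge between a vertex of $\mathrm{A}$ and a vertex of $\mathrm{B}$, $X_{\mathrm{A}}(x)$ and $X_{\mathrm{B}}(x)$ are independent under $P$ for every $x\in\mathcal{X}$. Distance: $x\lessdot y$ ($y$ covers $x$) if $x\prec y$ with nothing strictly between. $d_{\mathcal{L}}(\mathcal{G}_1,\mathcal{G}_2)$ is the minimum length (number of steps) of a sequence of graphs in $\mathfrak{G}$ from $\mathcal{G}_1$ to $\mathcal{G}_2$ in which of any two consecutive graphs one covers the other.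
   Formalization: Laws P must also satisfy: if, for each fixed y, dropping part of x_I a.s. leaves X_v(x_I,y_J) unchanged, the same holds at y_J=X_J(x_I). Automatic for countable state spaces; for uncountable ones the claim fails without it. State-space σ-algebras are taken countably separated. *)

theory Defs
  imports "HOL-Probability.Probability"
begin

section \<open>Acyclic directed mixed graphs\<close>

datatype 'v mixed_graph = Mixed_Graph (bidirected: "'v set set") (directed: "('v \<times> 'v) set")

text \<open>
  The vertex set is the whole (finite) type. Acyclicity of the directed part in particular
  excludes directed loops.
\<close>

definition admgs :: "'v::finite mixed_graph set" where
  "admgs = {G. (\<forall>e \<in> bidirected G. card e = 2) \<and> acyclic (directed G)}"

definition parents :: "'v mixed_graph \<Rightarrow> 'v \<Rightarrow> 'v set" where
  "parents G v = {w. (w, v) \<in> directed G}"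


section \<open>Potential outcome schedules\<close>

text \<open>
  The second condition says that countably many measurable sets separate the points. It holds for
  every standard Borel space and for every countable discrete space, and it makes equality of two
  random elements an event.
\<close>

definition state_space :: "'a measure \<Rightarrow> bool" where
  "state_space M \<longleftrightarrow>
     (infinite (space M) \<or> card (space M) \<ge> 2) \<and>
     (\<exists>C. countable C \<and> C \<subseteq> sets M \<and>
        (\<forall>a \<in> space M. \<forall>b \<in> space M. a \<noteq> b \<longrightarrow> (\<exists>c \<in> C. (a \<in> c) \<noteq> (b \<in> c))))"

abbreviation states :: "('v \<Rightarrow> 'a measure) \<Rightarrow> ('v \<Rightarrow> 'a) set" where
  "states S \<equiv> space (Pi\<^sub>M UNIV S)"

text \<open>
  An intervention is a partial map: its domain is the set of intervened variables.
  \<open>impose x I\<close> is the intervention \<open>x\<^sub>I\<close>, and \<open>impose x I ++ impose y J\<close> (with \<open>I\<close> and \<open>J\<close>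
  disjoint) is the joint intervention \<open>(x\<^sub>I, y\<^sub>J)\<close>.
\<close>

definition impose :: "('v \<Rightarrow> 'a) \<Rightarrow> 'v set \<Rightarrow> 'v \<rightharpoonup> 'a" where
  "impose x I = (Some \<circ> x) |` I"

definition interventions :: "('v \<Rightarrow> 'a measure) \<Rightarrow> ('v \<rightharpoonup> 'a) set" where
  "interventions S = {impose x I | x I. x \<in> states S}"

type_synonym ('v, 'a) schedule = "'v \<times> ('v \<rightharpoonup> 'a) \<Rightarrow> 'a"

definition schedules :: "('v \<Rightarrow> 'a measure) \<Rightarrow> ('v, 'a) schedule set" where
  "schedules S = (\<Pi>\<^sub>E (v, m) \<in> UNIV \<times> interventions S. space (S v))"

text \<open>
  \<open>outcome \<omega> m\<close> is \<open>X(m)\<close> evaluated at the sample point \<open>\<omega>\<close>. The outcome \<open>outcome \<omega> m v\<close> of an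
  intervened variable \<open>v \<in> dom m\<close> is a genuine random quantity; it is not set to the imposed value.
\<close>

definition outcome :: "('v, 'a) schedule \<Rightarrow> ('v \<rightharpoonup> 'a) \<Rightarrow> 'v \<Rightarrow> 'a" where
  "outcome \<omega> m = (\<lambda>v. \<omega> (v, m))"

text \<open>
  The schedule space carries any \<open>\<sigma>\<close>-algebra \<open>F\<close> for which the nested potential outcomes
  \<open>X\<^sub>v(x\<^sub>K, X\<^sub>J(x\<^sub>I))\<close> are random variables. The case \<open>J = {}\<close> says that \<open>F\<close> contains the product
  \<open>\<sigma>\<close>-algebra.
\<close>

definition schedule_space :: "('v \<Rightarrow> 'a measure) \<Rightarrow> ('v, 'a) schedule measure \<Rightarrow> bool" where
  "schedule_space S F \<longleftrightarrow>
     space F = schedules S \<and>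
     (\<forall>v I J K. \<forall>x \<in> states S. K \<subseteq> I \<longrightarrow> I \<inter> J = {} \<longrightarrow>
        (\<lambda>\<omega>. outcome \<omega> (impose x K ++ impose (outcome \<omega> (impose x I)) J) v) \<in> F \<rightarrow>\<^sub>M S v)"

text \<open>
  If leaving out a part of the intervention \<open>x\<^sub>I\<close> almost surely does not change \<open>X\<^sub>v(x\<^sub>I, y\<^sub>J)\<close>,
  for each fixed \<open>y\<close>, then it almost surely does not change \<open>X\<^sub>v(x\<^sub>I, X\<^sub>J(x\<^sub>I))\<close> either. For countable
  state spaces every law has this property (\<open>regular_law_countable\<close>). For uncountable ones it excludes
  pathological versions of the process, that is, potential outcomes which differ from one another
  on a null set depending on \<open>y\<close> in such a way that the random value \<open>X\<^sub>J(x\<^sub>I)\<close> detects the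
  difference.
\<close>

definition regular_law ::
  "('v \<Rightarrow> 'a measure) \<Rightarrow> ('v, 'a) schedule measure \<Rightarrow> bool" where
  "regular_law S P \<longleftrightarrow>
     (\<forall>v I J K. \<forall>x \<in> states S. K \<subseteq> I \<longrightarrow> I \<inter> J = {} \<longrightarrow>
        (\<forall>y \<in> states S. AE \<omega> in P.
           outcome \<omega> (impose x I ++ impose y J) v = outcome \<omega> (impose x K ++ impose y J) v) \<longrightarrow>
        (AE \<omega> in P.
           outcome \<omega> (impose x I ++ impose (outcome \<omega> (impose x I)) J) v =
           outcome \<omega> (impose x K ++ impose (outcome \<omega> (impose x I)) J) v))"

definition laws ::
  "('v \<Rightarrow> 'a measure) \<Rightarrow> ('v, 'a) schedule measure \<Rightarrow> ('v, 'a) schedule measure set" where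
  "laws S F = {P \<in> space (prob_algebra F). regular_law S P}"

lemma impose_restrict: "impose (restrict z J) J = impose z J"
  by (auto simp: impose_def restrict_map_def fun_eq_iff)

lemma outcome_in_states:
  assumes "\<omega> \<in> schedules S" "m \<in> interventions S"
  shows "outcome \<omega> m \<in> states S"
  using assms by (auto simp: schedules_def outcome_def space_PiM)

lemma regular_law_countable:
  fixes S :: "'v::finite \<Rightarrow> 'a measure"
  assumes countable: "\<And>v. countable (space (S v))"
    and space: "space P = schedules S"
  shows "regular_law S P"
  unfolding regular_law_def
proof (intro allI ballI impI)
  fix v I J K x
  assume x: "x \<in> states S"
    and eq: "\<forall>y \<in> states S. AE \<omega> in P.
      outcome \<omega> (impose x I ++ impose y J) v = outcome \<omega> (impose x K ++ impose y J) v"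
  have "countable (states S)"
    unfolding space_PiM by (rule countable_PiE) (auto simp: countable)
  with eq have "AE \<omega> in P. \<forall>y \<in> states S.
      outcome \<omega> (impose x I ++ impose y J) v = outcome \<omega> (impose x K ++ impose y J) v"
    by (subst AE_ball_countable) auto
  moreover have "AE \<omega> in P. outcome \<omega> (impose x I) \<in> states S"
    using x space by (intro AE_I2 outcome_in_states) (auto simp: interventions_def)
  ultimately show "AE \<omega> in P.
      outcome \<omega> (impose x I ++ impose (outcome \<omega> (impose x I)) J) v =
      outcome \<omega> (impose x K ++ impose (outcome \<omega> (impose x I)) J) v"
    by eventually_elim blast
qed


section \<open>Causal models\<close>

text \<open>\<open>\<kappa>\<close> is a regular conditional probability distribution of \<open>P\<close> given the \<open>N\<close>-valued \<open>Y\<close>.\<close>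

definition is_rcpd :: "'w measure \<Rightarrow> 'b measure \<Rightarrow> ('w \<Rightarrow> 'b) \<Rightarrow> ('b \<Rightarrow> 'w measure) \<Rightarrow> bool" where
  "is_rcpd P N Y \<kappa> \<longleftrightarrow>
     \<kappa> \<in> N \<rightarrow>\<^sub>M prob_algebra P \<and>
     (\<forall>A \<in> sets P. \<forall>B \<in> sets N.
        emeasure P (A \<inter> Y -` B) = (\<integral>\<^sup>+ y \<in> B. emeasure (\<kappa> y) A \<partial>distr P N Y))"

text \<open>
  The conditional probability given \<open>X\<^sub>I\<^sub>'(x\<^sub>I) = x'\<close> is read through a version \<open>\<kappa>\<close> of the regular
  conditional distribution, for which the equation holds at every \<open>x'\<close>. The existence of
  the conditional distributions is part of the condition.
\<close>

definition consistent :: "('v \<Rightarrow> 'a measure) \<Rightarrow> ('v, 'a) schedule measure \<Rightarrow> bool" where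
  "consistent S P \<longleftrightarrow>
     (\<forall>I I'. I \<inter> I' = {} \<longrightarrow> (\<forall>x \<in> states S.
        \<exists>\<kappa>. is_rcpd P (Pi\<^sub>M I' S) (\<lambda>\<omega>. restrict (outcome \<omega> (impose x I)) I') \<kappa> \<and>
          (\<forall>x' \<in> space (Pi\<^sub>M I' S). AE \<omega> in \<kappa> x'.
             outcome \<omega> (impose x I ++ impose x' I') = outcome \<omega> (impose x I))))"

definition ground_model ::
  "('v \<Rightarrow> 'a measure) \<Rightarrow> ('v, 'a) schedule measure \<Rightarrow> ('v, 'a) schedule measure set" where
  "ground_model S F = {P \<in> laws S F. consistent S P}"

definition exclusion ::
  "('v \<Rightarrow> 'a measure) \<Rightarrow> 'v mixed_graph \<Rightarrow> ('v, 'a) schedule measure \<Rightarrow> bool" where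
  "exclusion S G P \<longleftrightarrow>
     (\<forall>v I. \<forall>x \<in> states S. AE \<omega> in P.
        outcome \<omega> (impose x I) v =
        outcome \<omega> (impose x (parents G v \<inter> I) ++
                   impose (outcome \<omega> (impose x I)) (parents G v - I)) v)"

definition independence ::
  "('v \<Rightarrow> 'a measure) \<Rightarrow> 'v mixed_graph \<Rightarrow> ('v, 'a) schedule measure \<Rightarrow> bool" where
  "independence S G P \<longleftrightarrow>
     (\<forall>A B. A \<inter> B = {} \<longrightarrow> (\<forall>a \<in> A. \<forall>b \<in> B. {a, b} \<notin> bidirected G) \<longrightarrow>
        (\<forall>x \<in> states S. prob_space.indep_var P
           (Pi\<^sub>M A S) (\<lambda>\<omega>. restrict (outcome \<omega> (impose x UNIV)) A)
           (Pi\<^sub>M B S) (\<lambda>\<omega>. restrict (outcome \<omega> (impose x UNIV)) B)))"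

definition admg_model ::
  "('v \<Rightarrow> 'a measure) \<Rightarrow> ('v, 'a) schedule measure \<Rightarrow> 'v mixed_graph \<Rightarrow>
   ('v, 'a) schedule measure set" where
  "admg_model S F G = {P \<in> ground_model S F. exclusion S G P \<and> independence S G P}"

definition admg_le ::
  "('v \<Rightarrow> 'a measure) \<Rightarrow> ('v, 'a) schedule measure \<Rightarrow> 'v mixed_graph \<Rightarrow> 'v mixed_graph \<Rightarrow> bool" where
  "admg_le S F G\<^sub>1 G\<^sub>2 \<longleftrightarrow> admg_model S F G\<^sub>1 \<subseteq> admg_model S F G\<^sub>2"


section \<open>Distance in a poset\<close>

definition strictly_below :: "('b \<Rightarrow> 'b \<Rightarrow> bool) \<Rightarrow> 'b \<Rightarrow> 'b \<Rightarrow> bool" where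
  "strictly_below le a b \<longleftrightarrow> le a b \<and> a \<noteq> b"

text \<open>\<open>covered_by C le a b\<close>: in the poset \<open>(C, le)\<close>, \<open>b\<close> covers \<open>a\<close>.\<close>

definition covered_by :: "'b set \<Rightarrow> ('b \<Rightarrow> 'b \<Rightarrow> bool) \<Rightarrow> 'b \<Rightarrow> 'b \<Rightarrow> bool" where
  "covered_by C le a b \<longleftrightarrow>
     a \<in> C \<and> b \<in> C \<and> strictly_below le a b \<and>
     \<not> (\<exists>c \<in> C. strictly_below le a c \<and> strictly_below le c b)"

definition cover_paths :: "'b set \<Rightarrow> ('b \<Rightarrow> 'b \<Rightarrow> bool) \<Rightarrow> 'b \<Rightarrow> 'b \<Rightarrow> 'b list set" where
  "cover_paths C le a b =
     {p. p \<noteq> [] \<and> set p \<subseteq> C \<and> hd p = a \<and> last p = b \<and>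
         successively (\<lambda>c d. covered_by C le c d \<or> covered_by C le d c) p}"

text \<open>The distance is \<open>\<infinity>\<close> if no path exists.\<close>

definition cover_dist :: "'b set \<Rightarrow> ('b \<Rightarrow> 'b \<Rightarrow> bool) \<Rightarrow> 'b \<Rightarrow> 'b \<Rightarrow> enat" where
  "cover_dist C le a b = (INF p \<in> cover_paths C le a b. enat (length p - 1))"

end

(*
  The order is inclusion of both edge sets. Enlarging the edge sets enlarges the model: clearly for
  independence, and for exclusion because consistency gives X(x_I, X_J(x_I)) = X(x_I) almost
  surely, so that regularity of the law lets one drop the interventions on non-parents after
  substituting the random value X_J(x_I). Conversely, an edge of G_1 missing in G_2 is detected by
  a law with at most two atoms: for w -> v a single schedule in which v reacts only to w, for
  v <-> w a fair coin shared by two otherwise constant outcomes. Since subgraphs of ADMGs are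
  ADMGs, covers are exactly additions of one edge, and a shortest path deletes the edges of
  G_1 outside G_2 and then adds those of G_2 outside G_1.
*)

theory Submission
  imports Defs
begin

section \<open>Distances in families of finite sets closed under subsets\<close>

text \<open>Two features of the definitions shape the proof. Consistency speaks of a fixed value
  through a conditional law, whereas exclusion substitutes a random value. The bridge is that a
  conditional law given \<open>Y = y\<close> is carried by the event \<open>Y = y\<close> for almost
  every \<open>y\<close>; countable separation of points makes this provable, since equality becomes
  countably many membership conditions. Secondly, \<open>F\<close> may be any sigma-algebra that
  makes the nested outcomes measurable. The separating laws are therefore pushed forward from a
  discrete space, where every map is measurable, and an almost sure claim about them becomes a check
  at each atom. Their conditional kernels have to satisfy the consistency equation at every value,
  including values of probability zero, so a suitable default must be supplied there.\<close>

lemma sym_diff_triangle: "sym_diff A C \<subseteq> sym_diff A B \<union> sym_diff B C"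
  by blast

text \<open>This is all that the distance needs to know about ADMGs. Both kinds of edges are meant
  to be merged into one set \<open>e a\<close>, so that a cover adds a single element of either
  kind.\<close>

locale downset_poset =
  fixes C :: "'b set" and le :: "'b \<Rightarrow> 'b \<Rightarrow> bool" and e :: "'b \<Rightarrow> 'e set"
  assumes finite_e: "a \<in> C \<Longrightarrow> finite (e a)"
    and inj_e: "inj_on e C"
    and le_iff: "a \<in> C \<Longrightarrow> b \<in> C \<Longrightarrow> le a b \<longleftrightarrow> e a \<subseteq> e b"
    and down: "b \<in> C \<Longrightarrow> X \<subseteq> e b \<Longrightarrow> \<exists>a \<in> C. e a = X"
begin

lemma below_iff: "a \<in> C \<Longrightarrow> b \<in> C \<Longrightarrow> strictly_below le a b \<longleftrightarrow> e a \<subset> e b"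
  using inj_onD[OF inj_e] by (auto simp: strictly_below_def le_iff)

text \<open>If \<open>i\<close> lies in \<open>e b\<close> but not in \<open>e a\<close>, then
  \<open>insert i (e a)\<close> belongs to the family by \<open>down\<close> and sits between the
  two sets, so a cover leaves no room for a second new element.\<close>

lemma covered_by_iff:
  assumes "a \<in> C" "b \<in> C"
  shows "covered_by C le a b \<longleftrightarrow> (\<exists>i. i \<notin> e a \<and> e b = insert i (e a))"
proof
  assume cov: "covered_by C le a b"
  then have sub: "e a \<subset> e b"
    using assms by (auto simp: covered_by_def below_iff)
  then obtain i where i: "i \<in> e b" "i \<notin> e a" by blast
  obtain c where c: "c \<in> C" "e c = insert i (e a)"
    using down[OF assms(2), of "insert i (e a)"] i sub by blast
  have "\<not> (e a \<subset> e c \<and> e c \<subset> e b)"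
    using cov c(1) assms by (auto simp: covered_by_def below_iff)
  moreover have "e a \<subset> e c" "e c \<subseteq> e b"
    unfolding c(2) using i sub by auto
  ultimately have "e b = insert i (e a)"
    unfolding c(2)[symmetric] by blast
  then show "\<exists>i. i \<notin> e a \<and> e b = insert i (e a)"
    using i(2) by blast
next
  assume "\<exists>i. i \<notin> e a \<and> e b = insert i (e a)"
  then obtain i where i: "i \<notin> e a" "e b = insert i (e a)" by blast
  then have "e a \<subset> e b" by blast
  moreover have "\<not> (e a \<subset> e c \<and> e c \<subset> e b)" for c
    unfolding i(2) by blast
  ultimately show "covered_by C le a b"
    using assms unfolding covered_by_def by (simp add: below_iff)
qed

text \<open>The size of the symmetric difference obeys the triangle inequality, and one cover,
  upward or downward, changes a set by one element.\<close>

lemma card_sym_diff_le_path: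
  assumes "p \<in> cover_paths C le a b"
  shows "card (sym_diff (e a) (e b)) \<le> length p - 1"
  using assms
proof (induction p arbitrary: a)
  case Nil
  then show ?case by (simp add: cover_paths_def)
next
  case (Cons x p)
  have x: "x = a" "a \<in> C" using Cons.prems by (auto simp: cover_paths_def)
  show ?case
  proof (cases p)
    case Nil
    then show ?thesis using Cons.prems by (auto simp: cover_paths_def)
  next
    case (Cons y q)
    have y: "y \<in> C" "covered_by C le a y \<or> covered_by C le y a"
      using Cons.prems Cons by (auto simp: cover_paths_def)
    have "p \<in> cover_paths C le y b"
      using Cons.prems Cons by (auto simp: cover_paths_def)
    then have IH: "card (sym_diff (e y) (e b)) \<le> length p - 1" by (rule Cons.IH)
    have "last (x # p) \<in> set (x # p)" by (rule last_in_set) simp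
    then have b: "b \<in> C" using Cons.prems unfolding cover_paths_def by blast
    from y(2) obtain i where "e y = insert i (e a) \<or> e a = insert i (e y)"
      using covered_by_iff[OF x(2) y(1)] covered_by_iff[OF y(1) x(2)] by blast
    then have i: "sym_diff (e a) (e y) \<subseteq> {i}" by blast
    have "card (sym_diff (e a) (e b)) \<le> card (sym_diff (e a) (e y) \<union> sym_diff (e y) (e b))"
      using x y b by (intro card_mono sym_diff_triangle) (auto simp: finite_e)
    also have "\<dots> \<le> card (sym_diff (e a) (e y)) + card (sym_diff (e y) (e b))"
      by (rule card_Un_le)
    also have "card (sym_diff (e a) (e y)) \<le> 1"
      using card_mono[OF _ i] by simp
    finally show ?thesis using IH Cons by simp
  qed
qed

text \<open>Each induction step deletes an element from one of the two endpoints, so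
  \<open>down\<close> supplies the intermediate set. Adding an element of \<open>e b\<close> to
  \<open>e a\<close> in general could leave the family: a union of two acyclic graphs may have a
  cycle.\<close>

lemma path_exists:
  assumes "a \<in> C" "b \<in> C"
  shows "\<exists>p \<in> cover_paths C le a b. length p - 1 = card (sym_diff (e a) (e b))"
  using assms
proof (induction "card (sym_diff (e a) (e b))" arbitrary: a b)
  case 0
  then have "e a = e b" using finite_e by auto
  then have "a = b" using 0 inj_onD[OF inj_e] by blast
  then show ?case
    using 0 by (intro bexI[of _ "[a]"]) (auto simp: cover_paths_def)
next
  case (Suc n)
  have fin: "finite (e a)" "finite (e b)" using Suc finite_e by auto
  show ?case
  proof (cases "e a \<subseteq> e b")
    case False
    then obtain i where i: "i \<in> e a" "i \<notin> e b" by blast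
    obtain c where c: "c \<in> C" "e c = e a - {i}" using down[OF Suc.prems(1) Diff_subset] by metis
    have "sym_diff (e c) (e b) = sym_diff (e a) (e b) - {i}" unfolding c(2) using i by blast
    then have n: "n = card (sym_diff (e c) (e b))" using Suc.hyps(2) i fin by simp
    have "\<exists>p \<in> cover_paths C le c b. length p - 1 = card (sym_diff (e c) (e b))"
      by (rule Suc.hyps(1)[OF n c(1) Suc.prems(2)])
    then obtain p where p: "p \<in> cover_paths C le c b" "length p - 1 = n"
      by (metis n)
    have "covered_by C le c a"
      using c i Suc.prems by (subst covered_by_iff) blast+
    then have "a # p \<in> cover_paths C le a b"
      using p(1) Suc.prems unfolding cover_paths_def by (cases p) auto
    moreover have "length (a # p) - 1 = Suc n"
      using p unfolding cover_paths_def by (cases p) auto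
    ultimately show ?thesis unfolding Suc.hyps(2)[symmetric] by blast
  next
    \<comment> \<open>Nothing is left to delete from \<open>a\<close>. The last step of the path is
      found instead, by deleting from \<open>b\<close> and extending the path at its end.\<close>
    case True
    then have "e a \<noteq> e b" using Suc.hyps(2) by auto
    then obtain i where i: "i \<notin> e a" "i \<in> e b" using True by blast
    obtain c where c: "c \<in> C" "e c = e b - {i}" using down[OF Suc.prems(2) Diff_subset] by metis
    have "sym_diff (e a) (e c) = sym_diff (e a) (e b) - {i}" unfolding c(2) using i by blast
    then have n: "n = card (sym_diff (e a) (e c))" using Suc.hyps(2) i fin by simp
    have "\<exists>p \<in> cover_paths C le a c. length p - 1 = card (sym_diff (e a) (e c))"
      by (rule Suc.hyps(1)[OF n Suc.prems(1) c(1)])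
    then obtain p where p: "p \<in> cover_paths C le a c" "length p - 1 = n"
      by (metis n)
    have "covered_by C le c b"
      using c i Suc.prems by (subst covered_by_iff) blast+
    then have "p @ [b] \<in> cover_paths C le a b"
      using p(1) Suc.prems unfolding cover_paths_def by (auto simp: successively_append_iff)
    moreover have "length (p @ [b]) - 1 = Suc n"
      using p unfolding cover_paths_def by (cases p) auto
    ultimately show ?thesis unfolding Suc.hyps(2)[symmetric] by blast
  qed
qed

theorem cover_dist_eq:
  assumes "a \<in> C" "b \<in> C"
  shows "cover_dist C le a b = enat (card (sym_diff (e a) (e b)))"
  unfolding cover_dist_def
proof (rule antisym)
  obtain p where "p \<in> cover_paths C le a b" "length p - 1 = card (sym_diff (e a) (e b))"
    using path_exists[OF assms] by blast
  then show "(INF p \<in> cover_paths C le a b. enat (length p - 1)) \<le> enat (card (sym_diff (e a) (e b)))"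
    by (metis INF_lower)
  show "enat (card (sym_diff (e a) (e b))) \<le> (INF p \<in> cover_paths C le a b. enat (length p - 1))"
    by (intro INF_greatest, unfold enat_ord_simps, rule card_sym_diff_le_path)
qed

end

section \<open>Events of the schedule space\<close>

lemma impose_apply: "impose x I v = (if v \<in> I then Some (x v) else None)"
  by (simp add: impose_def restrict_map_def)

lemma impose_empty [simp]: "impose x {} = Map.empty"
  by (auto simp: impose_apply fun_eq_iff)

lemma impose_add: "impose x I ++ impose y J = impose (\<lambda>v. if v \<in> J then y v else x v) (I \<union> J)"
  by (auto simp: impose_apply fun_eq_iff map_add_def)

text \<open>The separation clause of \<open>state_space\<close> on its own: it passes to all
  products, while the product over the empty index set has a single point and is no state
  space.\<close>

definition countably_separated :: "'a measure \<Rightarrow> bool" where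
  "countably_separated M \<longleftrightarrow> (\<exists>C. countable C \<and> C \<subseteq> sets M \<and>
     (\<forall>a \<in> space M. \<forall>b \<in> space M. a \<noteq> b \<longrightarrow> (\<exists>c \<in> C. (a \<in> c) \<noteq> (b \<in> c))))"

lemma countably_separated_eq_iff:
  assumes "countably_separated M"
  shows "\<exists>C. countable C \<and> C \<subseteq> sets M \<and>
    (\<forall>a \<in> space M. \<forall>b \<in> space M. a = b \<longleftrightarrow> (\<forall>c \<in> C. a \<in> c \<longleftrightarrow> b \<in> c))"
proof -
  obtain C where C: "countable C" "C \<subseteq> sets M"
    "\<forall>a \<in> space M. \<forall>b \<in> space M. a \<noteq> b \<longrightarrow> (\<exists>c \<in> C. (a \<in> c) \<noteq> (b \<in> c))"
    using assms unfolding countably_separated_def by (elim exE conjE) (rule that)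
  have "a = b \<longleftrightarrow> (\<forall>c \<in> C. a \<in> c \<longleftrightarrow> b \<in> c)" if "a \<in> space M" "b \<in> space M" for a b
    using C(3) that by metis
  then show ?thesis using C(1,2) by (intro exI[of _ C] conjI ballI)
qed

text \<open>Equality is a countable conjunction of membership conditions. This makes the almost sure
  identities between outcomes genuine events.\<close>

lemma sets_Collect_eq:
  assumes N: "countably_separated N" and f: "f \<in> M \<rightarrow>\<^sub>M N" and g: "g \<in> M \<rightarrow>\<^sub>M N"
  shows "{\<omega> \<in> space M. f \<omega> = g \<omega>} \<in> sets M"
proof -
  obtain C where C: "countable C" "C \<subseteq> sets N"
    "\<forall>a \<in> space N. \<forall>b \<in> space N. a = b \<longleftrightarrow> (\<forall>c \<in> C. a \<in> c \<longleftrightarrow> b \<in> c)"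
    using countably_separated_eq_iff[OF N] by (elim exE conjE) (rule that)
  have "{\<omega> \<in> space M. f \<omega> = g \<omega>} = {\<omega> \<in> space M. \<forall>c \<in> C. f \<omega> \<in> c \<longleftrightarrow> g \<omega> \<in> c}"
    by (intro Collect_cong conj_cong refl C(3)[rule_format] measurable_space[OF f] measurable_space[OF g])
  also have "\<dots> \<in> sets M"
  proof (rule sets.sets_Collect_countable_All'[OF _ C(1)])
    fix c assume "c \<in> C"
    then have [measurable]: "c \<in> sets N" using C(2) by blast
    note f[measurable] g[measurable]
    show "{\<omega> \<in> space M. f \<omega> \<in> c \<longleftrightarrow> g \<omega> \<in> c} \<in> sets M" by measurable
  qed
  finally show ?thesis .
qed

lemma countably_separated_singleton:
  assumes "countably_separated N" "y \<in> space N"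
  shows "{y} \<in> sets N"
proof -
  have "{y} = {z \<in> space N. z = y}" using assms(2) by blast
  also have "\<dots> \<in> sets N"
    using sets_Collect_eq[OF assms(1), of "\<lambda>z. z" N "\<lambda>_. y"] assms(2) by simp
  finally show ?thesis .
qed

lemma countably_separated_PiM:
  fixes S :: "'v::finite \<Rightarrow> 'a measure"
  assumes "\<And>v. countably_separated (S v)"
  shows "countably_separated (Pi\<^sub>M I S)"
proof -
  have "\<exists>C. countable C \<and> C \<subseteq> sets (S v) \<and>
      (\<forall>a \<in> space (S v). \<forall>b \<in> space (S v). a \<noteq> b \<longrightarrow> (\<exists>c \<in> C. (a \<in> c) \<noteq> (b \<in> c)))" for v
    using assms[of v] by (simp add: countably_separated_def)
  then obtain C where C: "\<And>v. countable (C v)" "\<And>v. C v \<subseteq> sets (S v)"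
    "\<And>v a b. a \<in> space (S v) \<Longrightarrow> b \<in> space (S v) \<Longrightarrow> a \<noteq> b \<Longrightarrow> \<exists>c \<in> C v. (a \<in> c) \<noteq> (b \<in> c)"
    by metis
  \<comment> \<open>Cylinders over the separating sets of one coordinate suffice, because distinct
    points of the product differ in some coordinate; there are countably many, as the index type is
    finite.\<close>
  define D where "D = (\<Union>v \<in> I. (\<lambda>c. {y \<in> space (Pi\<^sub>M I S). y v \<in> c}) ` C v)"
  show ?thesis
    unfolding countably_separated_def
  proof (intro exI[of _ D] conjI ballI impI)
    show "countable D"
      unfolding D_def by (intro countable_UN countable_image C(1) countable_finite) auto
    show "D \<subseteq> sets (Pi\<^sub>M I S)"
    proof (clarsimp simp: D_def)
      fix v c assume "v \<in> I" "c \<in> C v"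
      then have [measurable]: "c \<in> sets (S v)" "v \<in> I" using C(2) by auto
      show "{y \<in> space (Pi\<^sub>M I S). y v \<in> c} \<in> sets (Pi\<^sub>M I S)" by measurable
    qed
    fix a b assume ab: "a \<in> space (Pi\<^sub>M I S)" "b \<in> space (Pi\<^sub>M I S)" "a \<noteq> b"
    then obtain v where v: "v \<in> I" "a v \<noteq> b v"
      by (metis PiE_ext space_PiM)
    then obtain c where c: "c \<in> C v" "(a v \<in> c) \<noteq> (b v \<in> c)"
      using C(3)[of "a v" v "b v"] ab v(1) PiE_mem[of a I "\<lambda>v. space (S v)" v]
        PiE_mem[of b I "\<lambda>v. space (S v)" v] unfolding space_PiM by metis
    have "{y \<in> space (Pi\<^sub>M I S). y v \<in> c} \<in> D" using v c by (auto simp: D_def)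
    then show "\<exists>d \<in> D. (a \<in> d) \<noteq> (b \<in> d)"
      using c(2) ab by (intro bexI) auto
  qed
qed

section \<open>Potential outcomes as random variables on the schedule space\<close>

locale potential_outcomes =
  fixes S :: "'v::finite \<Rightarrow> 'a measure" and F :: "('v, 'a) schedule measure"
  assumes states: "state_space (S v)"
    and schedules: "schedule_space S F"
begin

lemma separated: "countably_separated (S v)"
  using states[of v] by (simp add: state_space_def countably_separated_def)

lemma two_states: "\<exists>a b. a \<in> space (S v) \<and> b \<in> space (S v) \<and> a \<noteq> b"
proof -
  have two: "infinite (space (S v)) \<or> card (space (S v)) \<ge> 2"
    using states[of v] by (simp add: state_space_def)
  show ?thesis
  proof (rule ccontr)
    assume "\<not> ?thesis"
    then have eq: "\<forall>a \<in> space (S v). \<forall>b \<in> space (S v). a = b" by blast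
    have "finite (space (S v))"
    proof (cases "space (S v) = {}")
      case False
      then obtain a where "space (S v) \<subseteq> {a}" using eq by blast
      then show ?thesis by (rule finite_subset) simp
    qed simp
    then show False using two eq card_le_Suc0_iff_eq[of "space (S v)"] by auto
  qed
qed

text \<open>A baseline state and a deviating state for each variable, from which the separating laws
  are built. If a variable had only one state, no edge at it could be detected.\<close>

definition pt1 :: "'v \<Rightarrow> 'a" where "pt1 v = (SOME a. a \<in> space (S v))"
definition pt2 :: "'v \<Rightarrow> 'a" where "pt2 v = (SOME b. b \<in> space (S v) \<and> b \<noteq> pt1 v)"

lemma pt1: "pt1 v \<in> space (S v)"
  unfolding pt1_def by (rule someI_ex) (use two_states in blast)

lemma pt2: "pt2 v \<in> space (S v)" "pt2 v \<noteq> pt1 v"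
proof -
  have "\<exists>b. b \<in> space (S v) \<and> b \<noteq> pt1 v" using two_states[of v] by metis
  then have "pt2 v \<in> space (S v) \<and> pt2 v \<noteq> pt1 v" unfolding pt2_def by (rule someI_ex)
  then show "pt2 v \<in> space (S v)" "pt2 v \<noteq> pt1 v" by auto
qed

lemma states_iff: "x \<in> states S \<longleftrightarrow> (\<forall>v. x v \<in> space (S v))"
  by (auto simp: space_PiM)

lemma interventions_iff: "m \<in> interventions S \<longleftrightarrow> (\<forall>v a. m v = Some a \<longrightarrow> a \<in> space (S v))"
proof
  assume "m \<in> interventions S"
  then show "\<forall>v a. m v = Some a \<longrightarrow> a \<in> space (S v)"
    by (auto simp: interventions_def impose_apply states_iff split: if_splits)
next
  assume m: "\<forall>v a. m v = Some a \<longrightarrow> a \<in> space (S v)"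
  \<comment> \<open>\<open>interventions\<close> restricts total states, so the partial map is
    completed by the baseline state outside its domain.\<close>
  define x where "x v = (case m v of None \<Rightarrow> pt1 v | Some a \<Rightarrow> a)" for v
  have "x \<in> states S" using m pt1 by (auto simp: x_def states_iff split: option.split)
  moreover have "m = impose x (dom m)"
    by (auto simp: x_def impose_apply fun_eq_iff split: option.split)
  ultimately show "m \<in> interventions S" by (auto simp: interventions_def)
qed

lemma impose_interventions:
  "(\<And>v. v \<in> I \<Longrightarrow> x v \<in> space (S v)) \<Longrightarrow> impose x I \<in> interventions S"
  by (auto simp: interventions_iff impose_apply split: if_splits)

lemma add_interventions:
  "m \<in> interventions S \<Longrightarrow> n \<in> interventions S \<Longrightarrow> m ++ n \<in> interventions S"
  by (auto simp: interventions_iff map_add_Some_iff)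

lemma interventionsE:
  assumes "m \<in> interventions S"
  obtains x I where "x \<in> states S" "m = impose x I"
  using assms by (auto simp: interventions_def)

lemma space_F: "space F = schedules S"
  using schedules by (simp add: schedule_space_def)

lemma outcome_space: "\<omega> \<in> space F \<Longrightarrow> m \<in> interventions S \<Longrightarrow> outcome \<omega> m v \<in> space (S v)"
  using outcome_in_states[of \<omega> S m] by (auto simp: space_F states_iff)

lemma measurable_nested:
  assumes "x \<in> states S" "K \<subseteq> I" "I \<inter> J = {}"
  shows "(\<lambda>\<omega>. outcome \<omega> (impose x K ++ impose (outcome \<omega> (impose x I)) J) v) \<in> F \<rightarrow>\<^sub>M S v"
  using assms schedules by (auto simp: schedule_space_def)

lemma measurable_outcome:
  assumes "m \<in> interventions S"
  shows "(\<lambda>\<omega>. outcome \<omega> m v) \<in> F \<rightarrow>\<^sub>M S v"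
proof -
  obtain x I where "x \<in> states S" "m = impose x I" using assms by (rule interventionsE)
  then show ?thesis using measurable_nested[of x I I "{}" v] by simp
qed

lemma measurable_restrict_outcome:
  assumes "m \<in> interventions S"
  shows "(\<lambda>\<omega>. restrict (outcome \<omega> m) I) \<in> F \<rightarrow>\<^sub>M Pi\<^sub>M I S"
  by (intro measurable_restrict measurable_outcome assms)

lemma sets_outcome_eq:
  assumes "m \<in> interventions S" "n \<in> interventions S"
  shows "{\<omega> \<in> space F. outcome \<omega> m = outcome \<omega> n} \<in> sets F"
proof -
  have "{\<omega> \<in> space F. \<forall>v \<in> UNIV. outcome \<omega> m v = outcome \<omega> n v} \<in> sets F"
    by (intro sets.sets_Collect_finite_All sets_Collect_eq[OF separated measurable_outcome measurable_outcome] assms) simp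
  then show ?thesis by (simp add: fun_eq_iff)
qed

end

section \<open>Monotonicity in the edge sets\<close>

text \<open>
  For almost every \<open>y\<close> the conditional law \<open>\<kappa> y\<close> is concentrated on \<open>{Y = y}\<close>, because this
  event is determined by countably many sets. Hence \<open>y\<close> may be replaced by \<open>Y\<close>.
\<close>

lemma is_rcpd_AE:
  assumes rcpd: "is_rcpd P N Y \<kappa>" and Y: "Y \<in> P \<rightarrow>\<^sub>M N" and N: "countably_separated N"
    and Q: "{\<omega> \<in> space P. Q (Y \<omega>) \<omega>} \<in> sets P"
    and AE_Q: "\<And>y. y \<in> space N \<Longrightarrow> AE \<omega> in \<kappa> y. Q y \<omega>"
  shows "AE \<omega> in P. Q (Y \<omega>) \<omega>"
proof -
  obtain C where C: "countable C" "C \<subseteq> sets N"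
    "\<forall>a \<in> space N. \<forall>b \<in> space N. a = b \<longleftrightarrow> (\<forall>c \<in> C. a \<in> c \<longleftrightarrow> b \<in> c)"
    using countably_separated_eq_iff[OF N] by (elim exE conjE) (rule that)
  let ?R = "distr P N Y"
  have kernel: "\<kappa> \<in> N \<rightarrow>\<^sub>M prob_algebra P"
    and disint: "\<And>A B. A \<in> sets P \<Longrightarrow> B \<in> sets N \<Longrightarrow>
      emeasure P (A \<inter> Y -` B) = (\<integral>\<^sup>+ y \<in> B. emeasure (\<kappa> y) A \<partial>?R)"
    using rcpd by (auto simp: is_rcpd_def)
  have sets_kernel: "sets (\<kappa> y) = sets P" if "y \<in> space N" for y
    using measurable_space[OF kernel that] by (simp add: space_prob_algebra)
  have space_kernel: "space (\<kappa> y) = space P" if "y \<in> space N" for y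
    using sets_eq_imp_space_eq[OF sets_kernel[OF that]] .
  have meas: "(\<lambda>y. emeasure (\<kappa> y) A * indicator B y) \<in> borel_measurable ?R"
    if "A \<in> sets P" "B \<in> sets N" for A B
  proof -
    have "(\<lambda>y. emeasure (\<kappa> y) A) \<in> borel_measurable N"
      by (rule measurable_compose[OF measurable_prob_algebraD[OF kernel]
            measurable_emeasure_subprob_algebra[OF that(1)]])
    then show ?thesis using that(2) by simp
  qed
  \<comment> \<open>If \<open>A\<close> is disjoint from the preimage of \<open>B\<close>, the
    disintegration formula gives a nonnegative function with integral zero.\<close>
  have null: "AE y in ?R. y \<in> B \<longrightarrow> emeasure (\<kappa> y) A = 0"
    if "A \<in> sets P" "B \<in> sets N" "A \<inter> Y -` B = {}" for A B
  proof -
    have "(\<integral>\<^sup>+ y. emeasure (\<kappa> y) A * indicator B y \<partial>?R) = 0"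
      using disint[OF that(1,2)] that(3) by simp
    then have "AE y in ?R. emeasure (\<kappa> y) A * indicator B y = 0"
      using nn_integral_0_iff_AE[OF meas[OF that(1,2)]] by simp
    then show ?thesis by eventually_elim (auto simp: indicator_def)
  qed
  let ?pre = "\<lambda>c. Y -` c \<inter> space P"
  \<comment> \<open>For each separating set \<open>c\<close>, almost every \<open>\<kappa> y\<close>
    puts \<open>Y\<close> on the same side of \<open>c\<close> as \<open>y\<close>. Since
    \<open>C\<close> is countable, one null set of exceptional \<open>y\<close> serves all
    \<open>c\<close>.\<close>
  have "AE y in ?R. \<forall>c \<in> C. (y \<in> c \<longrightarrow> emeasure (\<kappa> y) (space P - ?pre c) = 0) \<and>
      (y \<in> space N - c \<longrightarrow> emeasure (\<kappa> y) (?pre c) = 0)"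
    unfolding AE_ball_countable[OF C(1)]
  proof
    fix c assume "c \<in> C"
    then have c: "c \<in> sets N" using C(2) by blast
    then have pre: "?pre c \<in> sets P" using measurable_sets[OF Y] by blast
    have "AE y in ?R. y \<in> c \<longrightarrow> emeasure (\<kappa> y) (space P - ?pre c) = 0"
      by (rule null) (use c pre in auto)
    moreover have "AE y in ?R. y \<in> space N - c \<longrightarrow> emeasure (\<kappa> y) (?pre c) = 0"
      by (rule null) (use c pre in auto)
    ultimately show "AE y in ?R. (y \<in> c \<longrightarrow> emeasure (\<kappa> y) (space P - ?pre c) = 0) \<and>
        (y \<in> space N - c \<longrightarrow> emeasure (\<kappa> y) (?pre c) = 0)"
      by eventually_elim blast
  qed
  moreover have "AE y in ?R. y \<in> space N" using AE_space[of ?R] by simp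
  ultimately have "AE y in ?R. emeasure (\<kappa> y) {\<omega> \<in> space P. \<not> Q (Y \<omega>) \<omega>} * indicator (space N) y = 0"
  proof eventually_elim
    case (elim y)
    have "AE \<omega> in \<kappa> y. \<forall>c \<in> C. Y \<omega> \<in> c \<longleftrightarrow> y \<in> c"
      unfolding AE_ball_countable[OF C(1)]
    proof
      fix c assume c: "c \<in> C"
      then have pre: "?pre c \<in> sets P" using C(2) measurable_sets[OF Y] by blast
      show "AE \<omega> in \<kappa> y. Y \<omega> \<in> c \<longleftrightarrow> y \<in> c"
      proof (cases "y \<in> c")
        case True
        then have "emeasure (\<kappa> y) (space P - ?pre c) = 0" using elim(1) c by blast
        then show ?thesis
          using True pre by (intro AE_I[of _ _ "space P - ?pre c"])
            (auto simp: space_kernel sets_kernel elim(2))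
      next
        case False
        then have "emeasure (\<kappa> y) (?pre c) = 0" using elim c by blast
        then show ?thesis
          using False pre by (intro AE_I[of _ _ "?pre c"])
            (auto simp: space_kernel sets_kernel elim(2))
      qed
    qed
    moreover have "AE \<omega> in \<kappa> y. \<omega> \<in> space P"
      using AE_space[of "\<kappa> y"] space_kernel[OF elim(2)] by simp
    ultimately have "AE \<omega> in \<kappa> y. Q (Y \<omega>) \<omega>"
      using AE_Q[OF elim(2)]
    proof eventually_elim
      case (elim \<omega>)
      have "Y \<omega> = y"
        using C(3)[rule_format, OF measurable_space[OF Y elim(2)] \<open>y \<in> space N\<close>] elim(1) by blast
      then show ?case using elim(3) by simp
    qed
    then have "emeasure (\<kappa> y) {\<omega> \<in> space (\<kappa> y). \<not> Q (Y \<omega>) \<omega>} = 0"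
      by (intro AE_E2) (use Q in \<open>auto simp: space_kernel sets_kernel elim(2)\<close>)
    then show ?case by (simp add: space_kernel elim(2))
  qed
  moreover have Z: "{\<omega> \<in> space P. \<not> Q (Y \<omega>) \<omega>} \<in> sets P"
    using Q by (rule sets.sets_Collect_neg)
  ultimately have "(\<integral>\<^sup>+ y. emeasure (\<kappa> y) {\<omega> \<in> space P. \<not> Q (Y \<omega>) \<omega>} * indicator (space N) y \<partial>?R) = 0"
    using nn_integral_0_iff_AE[OF meas[OF Z sets.top]] by simp
  then have "emeasure P ({\<omega> \<in> space P. \<not> Q (Y \<omega>) \<omega>} \<inter> Y -` space N) = 0"
    using disint[OF Z sets.top] by simp
  moreover have "{\<omega> \<in> space P. \<not> Q (Y \<omega>) \<omega>} \<inter> Y -` space N = {\<omega> \<in> space P. \<not> Q (Y \<omega>) \<omega>}"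
    using measurable_space[OF Y] by auto
  ultimately show ?thesis
    using Z by (intro AE_I[of _ _ "{\<omega> \<in> space P. \<not> Q (Y \<omega>) \<omega>}"]) auto
qed

context potential_outcomes
begin

lemma measurable_P: "P \<in> space (prob_algebra F) \<Longrightarrow> measurable P M = measurable F M"
  by (intro measurable_cong_sets) (auto simp: space_prob_algebra)

lemma sets_P: "P \<in> space (prob_algebra F) \<Longrightarrow> sets P = sets F"
  by (simp add: space_prob_algebra)

lemma space_P: "P \<in> space (prob_algebra F) \<Longrightarrow> space P = space F"
  by (intro sets_eq_imp_space_eq sets_P)

text \<open>Removes the conditioning: \<open>is_rcpd_AE\<close> replaces the fixed \<open>x'\<close>
  by the outcome itself. The outcome is restricted to \<open>J\<close> because the kernel is indexed
  by \<open>Pi\<^sub>M J S\<close>; imposing on \<open>J\<close> does not see the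
  restriction.\<close>

lemma consistent_AE:
  assumes P: "P \<in> space (prob_algebra F)" and cons: "consistent S P"
    and x: "x \<in> states S" and IJ: "I \<inter> J = {}"
  shows "AE \<omega> in P. outcome \<omega> (impose x I ++ impose (outcome \<omega> (impose x I)) J) = outcome \<omega> (impose x I)"
proof -
  have m: "impose x I \<in> interventions S" using x by (auto simp: interventions_def)
  let ?Y = "\<lambda>\<omega>. restrict (outcome \<omega> (impose x I)) J"
  obtain \<kappa> where \<kappa>: "is_rcpd P (Pi\<^sub>M J S) ?Y \<kappa>"
    "\<And>y. y \<in> space (Pi\<^sub>M J S) \<Longrightarrow>
      AE \<omega> in \<kappa> y. outcome \<omega> (impose x I ++ impose y J) = outcome \<omega> (impose x I)"
    using cons[unfolded consistent_def, rule_format, OF IJ x] by (elim exE conjE) (rule that, auto)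
  have "{\<omega> \<in> space F. \<forall>v \<in> UNIV.
      outcome \<omega> (impose x I ++ impose (outcome \<omega> (impose x I)) J) v = outcome \<omega> (impose x I) v} \<in> sets F"
    by (intro sets.sets_Collect_finite_All sets_Collect_eq[OF separated measurable_nested measurable_outcome]
        x m IJ) auto
  then have "{\<omega> \<in> space P. outcome \<omega> (impose x I ++ impose (?Y \<omega>) J) = outcome \<omega> (impose x I)} \<in> sets P"
    by (simp add: fun_eq_iff impose_restrict space_P[OF P] sets_P[OF P])
  moreover have "?Y \<in> P \<rightarrow>\<^sub>M Pi\<^sub>M J S"
    unfolding measurable_P[OF P] by (rule measurable_restrict_outcome[OF m])
  ultimately have "AE \<omega> in P. outcome \<omega> (impose x I ++ impose (?Y \<omega>) J) = outcome \<omega> (impose x I)"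
    by (intro is_rcpd_AE[OF \<kappa>(1) _ countably_separated_PiM[OF separated]] \<kappa>(2))
  then show ?thesis by (simp add: impose_restrict)
qed

lemma exclusion_mono:
  assumes P: "P \<in> ground_model S F" and excl: "exclusion S G P"
    and sub: "directed G \<subseteq> directed H"
  shows "exclusion S H P"
  unfolding exclusion_def
proof (intro allI ballI)
  fix v I x assume x: "x \<in> states S"
  have P': "P \<in> space (prob_algebra F)" "regular_law S P" "consistent S P"
    using P by (auto simp: ground_model_def laws_def)
  define J where "J = parents H v - I"
  define K where "K = parents H v \<inter> I"
  have pa: "parents G v \<subseteq> parents H v" using sub by (auto simp: parents_def)
  have "AE \<omega> in P. outcome \<omega> (impose x I ++ impose y J) v = outcome \<omega> (impose x K ++ impose y J) v"
    if y: "y \<in> states S" for y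
  proof -
    \<comment> \<open>Gluing \<open>y\<close> into \<open>x\<close> turns both joint interventions
      into interventions by the same state \<open>z\<close>, on \<open>I \<union> J\<close> and on
      \<open>K \<union> J\<close>.\<close>
    define z where "z = (\<lambda>v. if v \<in> J then y v else x v)"
    have z: "z \<in> states S" using x y by (auto simp: z_def states_iff)
    \<comment> \<open>Once all parents in \<open>G\<close> are intervened on, exclusion substitutes
      nothing random. Both interventions are thus compared with the common one on
      \<open>parents G v\<close>.\<close>
    have eq: "AE \<omega> in P. outcome \<omega> (impose z L) v = outcome \<omega> (impose z (parents G v)) v"
      if "parents H v \<subseteq> L" for L
    proof -
      have L: "parents G v \<inter> L = parents G v" "parents G v - L = {}" using that pa by auto
      show ?thesis
        using excl[unfolded exclusion_def, rule_format, OF z, of L v]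
        unfolding L impose_empty map_add_empty .
    qed
    have "parents H v \<subseteq> I \<union> J" "parents H v \<subseteq> K \<union> J" by (auto simp: J_def K_def)
    from eq[OF this(1)] eq[OF this(2)] show ?thesis
      unfolding impose_add z_def by eventually_elim simp
  qed
  moreover have "K \<subseteq> I" "I \<inter> J = {}" by (auto simp: J_def K_def)
  ultimately have "AE \<omega> in P. outcome \<omega> (impose x I ++ impose (outcome \<omega> (impose x I)) J) v =
      outcome \<omega> (impose x K ++ impose (outcome \<omega> (impose x I)) J) v"
    using P'(2)[unfolded regular_law_def, rule_format, OF x, of K I J v] by blast
  moreover have "AE \<omega> in P. outcome \<omega> (impose x I ++ impose (outcome \<omega> (impose x I)) J) = outcome \<omega> (impose x I)"
    by (rule consistent_AE[OF P'(1,3) x]) (auto simp: J_def)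
  ultimately show "AE \<omega> in P. outcome \<omega> (impose x I) v =
      outcome \<omega> (impose x (parents H v \<inter> I) ++ impose (outcome \<omega> (impose x I)) (parents H v - I)) v"
    unfolding J_def K_def by eventually_elim simp
qed

lemma independence_mono:
  "independence S G P \<Longrightarrow> bidirected G \<subseteq> bidirected H \<Longrightarrow> independence S H P"
  unfolding independence_def by blast

lemma admg_le_mono:
  "bidirected G \<subseteq> bidirected H \<Longrightarrow> directed G \<subseteq> directed H \<Longrightarrow> admg_le S F G H"
  unfolding admg_le_def admg_model_def using exclusion_mono independence_mono by blast

end

section \<open>Laws with finitely many atoms\<close>

text \<open>Meant for conditional kernels of atomic laws, which are constant away from the finitely
  many values that carry mass.\<close>

lemma measurable_finitely_many_values:
  assumes D: "finite D" and sing: "\<And>y. y \<in> D \<Longrightarrow> {y} \<in> sets N"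
    and f: "\<And>y. y \<in> space N \<Longrightarrow> f y \<in> space M"
    and c: "\<And>y. y \<in> space N - D \<Longrightarrow> f y = c"
  shows "f \<in> N \<rightarrow>\<^sub>M M"
proof (rule measurableI)
  fix B assume "B \<in> sets M"
  have fin: "E \<in> sets N" if "E \<subseteq> D" for E
  proof -
    have "(\<Union>y \<in> E. {y}) \<in> sets N"
      using that D sing by (intro sets.finite_UN) (auto intro: finite_subset)
    then show ?thesis by simp
  qed
  have "f -` B \<inter> space N = {y \<in> D. f y \<in> B \<and> y \<in> space N} \<union> (if c \<in> B then space N - D else {})"
    using c by auto
  also have "\<dots> \<in> sets N"
    using fin[of "{y \<in> D. f y \<in> B \<and> y \<in> space N}"] sets.compl_sets[OF fin[of D]] by auto
  finally show "f -` B \<inter> space N \<in> sets N" .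
qed (rule f)

text \<open>Drawing \<open>u\<close> and then redrawing from \<open>p\<close> conditioned on the
  value \<open>Y u\<close> reproduces \<open>p\<close>. Under the conditioned law \<open>Y\<close>
  is constant, so membership in \<open>B\<close> factors out as an indicator.\<close>

lemma emeasure_cond_pmf_split:
  fixes p :: "'u pmf" and Y :: "'u \<Rightarrow> 'b"
  shows "emeasure p {u. u \<in> A \<and> Y u \<in> B} =
    (\<integral>\<^sup>+ u. emeasure (cond_pmf p {u'. Y u' = Y u}) A * indicator B (Y u) \<partial>p)"
proof -
  have ne: "set_pmf p \<inter> {u'. Y u' = Y u} \<noteq> {}" if "u \<in> set_pmf p" for u
    using that by blast
  have bind: "bind_pmf p (\<lambda>u. cond_pmf p {u'. Y u' = Y u}) = p"
    by (rule bind_cond_pmf_cancel) (auto simp: eq_commute)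
  have "emeasure p {u. u \<in> A \<and> Y u \<in> B} =
      emeasure (bind_pmf p (\<lambda>u. cond_pmf p {u'. Y u' = Y u})) {u. u \<in> A \<and> Y u \<in> B}" by (simp only: bind)
  also have "\<dots> = (\<integral>\<^sup>+ u. emeasure (cond_pmf p {u'. Y u' = Y u}) {u. u \<in> A \<and> Y u \<in> B} \<partial>p)"
    by (rule emeasure_bind_pmf)
  also have "\<dots> = (\<integral>\<^sup>+ u. emeasure (cond_pmf p {u'. Y u' = Y u}) A * indicator B (Y u) \<partial>p)"
  proof (rule nn_integral_cong_AE, rule AE_pmfI)
    fix u assume u: "u \<in> set_pmf p"
    have "emeasure (cond_pmf p {u'. Y u' = Y u}) {u. u \<in> A \<and> Y u \<in> B} =
        emeasure (cond_pmf p {u'. Y u' = Y u}) (if Y u \<in> B then A else {})"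
      by (rule emeasure_eq_AE) (auto simp: AE_measure_pmf_iff set_cond_pmf[OF ne[OF u]])
    then show "emeasure (cond_pmf p {u'. Y u' = Y u}) {u. u \<in> A \<and> Y u \<in> B} =
        emeasure (cond_pmf p {u'. Y u' = Y u}) A * indicator B (Y u)"
      by (auto simp: indicator_def)
  qed
  finally show ?thesis .
qed

lemma prob_algebra_cong: "sets M = sets N \<Longrightarrow> prob_algebra M = prob_algebra N"
  by (simp add: prob_algebra_def cong: subprob_algebra_cong)

context potential_outcomes
begin

definition schedule_of :: "('v \<Rightarrow> ('v \<rightharpoonup> 'a) \<Rightarrow> 'a) \<Rightarrow> ('v, 'a) schedule" where
  "schedule_of f = restrict (\<lambda>(v, m). f v m) (UNIV \<times> interventions S)"

lemma outcome_schedule_of: "m \<in> interventions S \<Longrightarrow> outcome (schedule_of f) m = (\<lambda>v. f v m)"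
  by (auto simp: outcome_def schedule_of_def)

lemma schedule_of_space:
  "(\<And>v m. m \<in> interventions S \<Longrightarrow> f v m \<in> space (S v)) \<Longrightarrow> schedule_of f \<in> space F"
  by (auto simp: space_F schedules_def schedule_of_def)

text \<open>Consistency of a single sample point, in the substituted form that involves no
  conditioning.\<close>

definition consistent_schedule :: "('v, 'a) schedule \<Rightarrow> bool" where
  "consistent_schedule \<omega> \<longleftrightarrow> (\<forall>x \<in> states S. \<forall>I J. I \<inter> J = {} \<longrightarrow>
     outcome \<omega> (impose x I ++ impose (outcome \<omega> (impose x I)) J) = outcome \<omega> (impose x I))"

text \<open>A push-forward rather than a measure described on \<open>F\<close>: singletons of
  schedules need not be events there.\<close>

definition atomic_law :: "'u pmf \<Rightarrow> ('u \<Rightarrow> ('v, 'a) schedule) \<Rightarrow> ('v, 'a) schedule measure" where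
  "atomic_law p W = distr (measure_pmf p) F W"

context
  fixes p :: "'u pmf" and W :: "'u \<Rightarrow> ('v, 'a) schedule"
  assumes W: "W u \<in> space F"
begin

lemma measurable_W: "W \<in> measure_pmf q \<rightarrow>\<^sub>M F"
  using W by simp

lemma atomic_law_prob: "atomic_law p W \<in> space (prob_algebra F)"
  unfolding atomic_law_def space_prob_algebra
  using measure_pmf.prob_space_distr[OF measurable_W] by simp

lemma AE_atomic_law:
  "{\<omega> \<in> space F. Q \<omega>} \<in> sets F \<Longrightarrow> (AE \<omega> in atomic_law p W. Q \<omega>) \<longleftrightarrow> (\<forall>u \<in> set_pmf p. Q (W u))"
  unfolding atomic_law_def by (subst AE_distr_iff[OF measurable_W]) (auto simp: AE_measure_pmf_iff)

lemma AE_atomic_law_outcome: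
  assumes "x \<in> states S" "y \<in> states S" "x' \<in> states S" "y' \<in> states S"
  shows "(AE \<omega> in atomic_law p W. outcome \<omega> (impose x I ++ impose y J) v = outcome \<omega> (impose x' K ++ impose y' L) v)
    \<longleftrightarrow> (\<forall>u \<in> set_pmf p. outcome (W u) (impose x I ++ impose y J) v = outcome (W u) (impose x' K ++ impose y' L) v)"
  using assms
  by (intro AE_atomic_law sets_Collect_eq[OF separated measurable_outcome measurable_outcome]
      add_interventions impose_interventions) (auto simp: states_iff)

lemma AE_atomic_law_nested:
  assumes "x \<in> states S" "K \<subseteq> I" "K' \<subseteq> I" "I \<inter> J = {}" "I \<inter> J' = {}"
  shows "(AE \<omega> in atomic_law p W.
      outcome \<omega> (impose x K ++ impose (outcome \<omega> (impose x I)) J) v =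
      outcome \<omega> (impose x K' ++ impose (outcome \<omega> (impose x I)) J') v)
    \<longleftrightarrow> (\<forall>u \<in> set_pmf p.
      outcome (W u) (impose x K ++ impose (outcome (W u) (impose x I)) J) v =
      outcome (W u) (impose x K' ++ impose (outcome (W u) (impose x I)) J') v)"
  by (intro AE_atomic_law sets_Collect_eq[OF separated measurable_nested measurable_nested] assms)

text \<open>Almost surely means at every atom, so no exceptional null set can depend on
  \<open>y\<close>, and at the atom \<open>u\<close> the hypothesis may be applied to the outcome of
  \<open>W u\<close> itself.\<close>

lemma regular_atomic_law: "regular_law S (atomic_law p W)"
  unfolding regular_law_def
proof (intro allI ballI impI)
  fix v I J K x
  assume x: "x \<in> states S" and KI: "K \<subseteq> I" and IJ: "I \<inter> J = {}"
    and eq: "\<forall>y \<in> states S. AE \<omega> in atomic_law p W.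
      outcome \<omega> (impose x I ++ impose y J) v = outcome \<omega> (impose x K ++ impose y J) v"
  have "outcome (W u) (impose x I ++ impose (outcome (W u) (impose x I)) J) v =
      outcome (W u) (impose x K ++ impose (outcome (W u) (impose x I)) J) v" if u: "u \<in> set_pmf p" for u
  proof -
    have "outcome (W u) (impose x I) \<in> states S"
      unfolding states_iff
      using W x by (intro allI outcome_space impose_interventions) (auto simp: states_iff)
    then show ?thesis
      using eq[rule_format, of "outcome (W u) (impose x I)"] u x
      by (simp add: AE_atomic_law_outcome)
  qed
  then show "AE \<omega> in atomic_law p W. outcome \<omega> (impose x I ++ impose (outcome \<omega> (impose x I)) J) v =
      outcome \<omega> (impose x K ++ impose (outcome \<omega> (impose x I)) J) v"
    using AE_atomic_law_nested[OF x _ KI IJ IJ, of I v] by simp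
qed

lemma exclusion_atomic_law:
  "exclusion S G (atomic_law p W) \<longleftrightarrow> (\<forall>v I. \<forall>x \<in> states S. \<forall>u \<in> set_pmf p.
     outcome (W u) (impose x I) v =
     outcome (W u) (impose x (parents G v \<inter> I) ++
       impose (outcome (W u) (impose x I)) (parents G v - I)) v)"
proof -
  have "(AE \<omega> in atomic_law p W. outcome \<omega> (impose x I) v =
      outcome \<omega> (impose x (parents G v \<inter> I) ++ impose (outcome \<omega> (impose x I)) (parents G v - I)) v)
    \<longleftrightarrow> (\<forall>u \<in> set_pmf p. outcome (W u) (impose x I) v =
      outcome (W u) (impose x (parents G v \<inter> I) ++
        impose (outcome (W u) (impose x I)) (parents G v - I)) v)" if "x \<in> states S" for v I x
    using AE_atomic_law_nested[OF that, of I I "parents G v \<inter> I" "{}" "parents G v - I" v] by simp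
  then show ?thesis unfolding exclusion_def by (intro all_cong1 ball_cong refl)
qed

text \<open>The values not attained at any atom form a null set, so the kernel can be prescribed
  there; \<open>W0\<close> is left open so that the consistency proof can choose it.\<close>

lemma rcpd_atomic_law:
  assumes fin: "finite (set_pmf p)" and Y: "Y \<in> F \<rightarrow>\<^sub>M N" and N: "countably_separated N"
    and W0: "W0 \<in> space F"
  defines "\<kappa> \<equiv> \<lambda>y. if y \<in> (\<lambda>u. Y (W u)) ` set_pmf p
    then distr (measure_pmf (cond_pmf p {u. Y (W u) = y})) F W else return F W0"
  shows "is_rcpd (atomic_law p W) N Y \<kappa>"
  unfolding is_rcpd_def
proof (intro conjI ballI)
  have sets: "sets (atomic_law p W) = sets F" by (simp add: atomic_law_def)
  have YW: "Y (W u) \<in> space N" for u using measurable_space[OF Y W] .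
  have \<kappa>: "\<kappa> y \<in> space (prob_algebra F)" for y
    unfolding \<kappa>_def space_prob_algebra
    using measure_pmf.prob_space_distr[OF measurable_W] prob_space_return[OF W0] by simp
  show "\<kappa> \<in> N \<rightarrow>\<^sub>M prob_algebra (atomic_law p W)"
    unfolding prob_algebra_cong[OF sets]
  proof (rule measurable_finitely_many_values)
    show "finite ((\<lambda>u. Y (W u)) ` set_pmf p)" using fin by simp
    show "{y} \<in> sets N" if "y \<in> (\<lambda>u. Y (W u)) ` set_pmf p" for y
      using that YW by (intro countably_separated_singleton[OF N]) auto
    show "\<kappa> y = return F W0" if "y \<in> space N - (\<lambda>u. Y (W u)) ` set_pmf p" for y
      using that by (simp add: \<kappa>_def)
  qed (rule \<kappa>)
  fix A B assume A: "A \<in> sets (atomic_law p W)" and B: "B \<in> sets N"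
  have A': "A \<in> sets F" using A sets by simp
  have AB: "A \<inter> Y -` B \<in> sets F"
  proof -
    have "A \<inter> Y -` B = A \<inter> (Y -` B \<inter> space F)" using sets.sets_into_space[OF A'] by blast
    also have "\<dots> \<in> sets F" using measurable_sets[OF Y B] A' by blast
    finally show ?thesis .
  qed
  have "emeasure (atomic_law p W) (A \<inter> Y -` B) = emeasure p {u. u \<in> W -` A \<and> Y (W u) \<in> B}"
    unfolding atomic_law_def emeasure_distr[OF measurable_W AB]
    by (rule arg_cong[of _ _ "emeasure p"]) auto
  also have "\<dots> = (\<integral>\<^sup>+ u. emeasure (cond_pmf p {u'. Y (W u') = Y (W u)}) (W -` A) * indicator B (Y (W u)) \<partial>p)"
    by (rule emeasure_cond_pmf_split)
  also have "\<dots> = (\<integral>\<^sup>+ u. emeasure (\<kappa> (Y (W u))) A * indicator B (Y (W u)) \<partial>p)"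
    by (rule nn_integral_cong_AE, rule AE_pmfI)
      (auto simp: \<kappa>_def emeasure_distr[OF measurable_W A'])
  also have "\<dots> = (\<integral>\<^sup>+ y \<in> B. emeasure (\<kappa> y) A \<partial>distr (atomic_law p W) N Y)"
  proof -
    have "(\<lambda>y. emeasure (\<kappa> y) A * indicator B y) \<in> borel_measurable N"
    proof -
      have "\<kappa> \<in> N \<rightarrow>\<^sub>M prob_algebra F"
        using \<open>\<kappa> \<in> N \<rightarrow>\<^sub>M prob_algebra (atomic_law p W)\<close> by (simp only: prob_algebra_cong[OF sets])
      then have "(\<lambda>y. emeasure (\<kappa> y) A) \<in> borel_measurable N"
        by (intro measurable_compose[OF measurable_prob_algebraD
              measurable_emeasure_subprob_algebra[OF A']])
      then show ?thesis using B by simp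
    qed
    moreover have "distr (atomic_law p W) N Y = distr p N (\<lambda>u. Y (W u))"
      unfolding atomic_law_def by (subst distr_distr[OF Y measurable_W]) (simp add: o_def)
    ultimately show ?thesis using YW by (simp add: nn_integral_distr)
  qed
  finally show "emeasure (atomic_law p W) (A \<inter> Y -` B) =
    (\<integral>\<^sup>+ y \<in> B. emeasure (\<kappa> y) A \<partial>distr (atomic_law p W) N Y)" .
qed

end

end

section \<open>The order is inclusion of edge sets\<close>

context potential_outcomes
begin

lemma consistent_atomic_law:
  assumes W: "\<And>u. W u \<in> space F" and fin: "finite (set_pmf p)"
    and cons: "\<And>u. u \<in> set_pmf p \<Longrightarrow> consistent_schedule (W u)"
  shows "consistent S (atomic_law p W)"
  unfolding consistent_def
proof (intro allI impI ballI)
  fix I J :: "'v set" and x assume IJ: "I \<inter> J = {}" and x: "x \<in> states S"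
  have m: "impose x I \<in> interventions S" using x by (auto simp: interventions_def)
  let ?Y = "\<lambda>\<omega>. restrict (outcome \<omega> (impose x I)) J"
  \<comment> \<open>The conditional law at values \<open>y\<close> without mass is a constant schedule, which satisfies the
    consistency equation for every \<open>y\<close>.\<close>
  define W0 where "W0 = schedule_of (\<lambda>v _. pt1 v)"
  have W0: "W0 \<in> space F" unfolding W0_def by (intro schedule_of_space pt1)
  define \<kappa> where "\<kappa> y = (if y \<in> (\<lambda>u. ?Y (W u)) ` set_pmf p
    then distr (measure_pmf (cond_pmf p {u. ?Y (W u) = y})) F W else return F W0)" for y
  have "is_rcpd (atomic_law p W) (Pi\<^sub>M J S) ?Y \<kappa>"
    unfolding \<kappa>_def
    by (rule rcpd_atomic_law[OF W fin measurable_restrict_outcome[OF m] countably_separated_PiM[OF separated] W0])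
  moreover have "AE \<omega> in \<kappa> y. outcome \<omega> (impose x I ++ impose y J) = outcome \<omega> (impose x I)"
    if y: "y \<in> space (Pi\<^sub>M J S)" for y
  proof -
    have m': "impose x I ++ impose y J \<in> interventions S"
      using y by (intro add_interventions m impose_interventions) (auto simp: space_PiM)
    note meas = sets_outcome_eq[OF m' m]
    show ?thesis
    proof (cases "y \<in> (\<lambda>u. ?Y (W u)) ` set_pmf p")
      case True
      then have ne: "set_pmf p \<inter> {u. ?Y (W u) = y} \<noteq> {}" by blast
      \<comment> \<open>Conditioning retains only atoms whose own outcome on \<open>J\<close> is
        \<open>y\<close>, so imposing \<open>y\<close> is imposing that outcome.\<close>
      have "outcome (W u) (impose x I ++ impose y J) = outcome (W u) (impose x I)"
        if "u \<in> set_pmf (cond_pmf p {u. ?Y (W u) = y})" for u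
      proof -
        have u: "u \<in> set_pmf p" "?Y (W u) = y" using that set_cond_pmf[OF ne] by auto
        have "impose y J = impose (outcome (W u) (impose x I)) J"
          unfolding u(2)[symmetric] by (rule impose_restrict)
        then show ?thesis using cons[OF u(1)] x IJ by (simp add: consistent_schedule_def)
      qed
      then have "AE \<omega> in atomic_law (cond_pmf p {u. ?Y (W u) = y}) W.
          outcome \<omega> (impose x I ++ impose y J) = outcome \<omega> (impose x I)"
        by (simp add: AE_atomic_law[OF W meas])
      then show ?thesis by (simp only: \<kappa>_def True if_True atomic_law_def)
    next
      case False
      have "outcome W0 (impose x I ++ impose y J) = outcome W0 (impose x I)"
        by (simp add: W0_def outcome_schedule_of m m')
      then have "AE \<omega> in return F W0. outcome \<omega> (impose x I ++ impose y J) = outcome \<omega> (impose x I)"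
        using AE_return[OF W0, of "\<lambda>\<omega>. outcome \<omega> (impose x I ++ impose y J) = outcome \<omega> (impose x I)"] meas
        by (simp add: pred_def)
      then show ?thesis by (simp only: \<kappa>_def False if_False)
    qed
  qed
  ultimately show "\<exists>\<kappa>. is_rcpd (atomic_law p W) (Pi\<^sub>M J S) ?Y \<kappa> \<and>
      (\<forall>x' \<in> space (Pi\<^sub>M J S). AE \<omega> in \<kappa> x'.
        outcome \<omega> (impose x I ++ impose x' J) = outcome \<omega> (impose x I))"
    by blast
qed

lemma atomic_law_admg_model_iff:
  assumes "\<And>u. W u \<in> space F" "finite (set_pmf p)"
    "\<And>u. u \<in> set_pmf p \<Longrightarrow> consistent_schedule (W u)"
  shows "atomic_law p W \<in> admg_model S F G \<longleftrightarrow>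
    exclusion S G (atomic_law p W) \<and> independence S G (atomic_law p W)"
  using atomic_law_prob[where W = W and p = p, OF assms(1)]
    regular_atomic_law[where W = W and p = p, OF assms(1)]
    consistent_atomic_law[where W = W and p = p, OF assms]
  by (simp add: admg_model_def ground_model_def laws_def)

lemma measure_atomic_law:
  "(\<And>u. W u \<in> space F) \<Longrightarrow> A \<in> sets F \<Longrightarrow> measure (atomic_law p W) A = measure p {u. W u \<in> A}"
  unfolding atomic_law_def by (subst measure_distr[OF measurable_W]) (auto simp: vimage_def)

text \<open>An almost surely constant variable is independent of every other one. This one case
  yields the independence conditions of both separating laws.\<close>

lemma indep_var_atomic_law:
  assumes W: "\<And>u. W u \<in> space F"
    and X: "X \<in> F \<rightarrow>\<^sub>M M" and Y: "Y \<in> F \<rightarrow>\<^sub>M N"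
    and const: "(\<forall>u \<in> set_pmf p. X (W u) = c) \<or> (\<forall>u \<in> set_pmf p. Y (W u) = d)"
  shows "prob_space.indep_var (atomic_law p W) M X N Y"
proof -
  let ?P = "atomic_law p W"
  interpret P: prob_space ?P
    using atomic_law_prob[OF W, of p] by (simp add: space_prob_algebra)
  have sets: "sets ?P = sets F" and space: "space ?P = space F" by (auto simp: atomic_law_def)
  \<comment> \<open>Preimages of a sigma-algebra already form a sigma-algebra, so the product rule
    need only be checked on preimages.\<close>
  have gen: "sigma_sets (space F) {Z -` A \<inter> space F |A. A \<in> sets K} = {Z -` A \<inter> space F |A. A \<in> sets K}"
    if "Z \<in> F \<rightarrow>\<^sub>M K" for Z and K :: "'c measure"
    using sigma_sets_vimage_commute[of Z "space F" "space K" "sets K"] measurable_space[OF that]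
    by (auto simp: sets.sigma_sets_eq)
  have rv: "P.random_variable M X" "P.random_variable N Y"
    using X Y by (simp_all add: measurable_cong_sets[OF sets refl])
  have prod: "P.prob ((X -` A \<inter> space F) \<inter> (Y -` B \<inter> space F)) =
      P.prob (X -` A \<inter> space F) * P.prob (Y -` B \<inter> space F)"
    if "A \<in> sets M" "B \<in> sets N" for A B
  proof -
    let ?a = "X -` A \<inter> space F" and ?b = "Y -` B \<inter> space F"
    have ab: "?a \<in> sets F" "?b \<in> sets F" "?a \<inter> ?b \<in> sets F"
      using measurable_sets[OF X that(1)] measurable_sets[OF Y that(2)] by auto
    have m: "P.prob ?a = measure p {u. X (W u) \<in> A}" "P.prob ?b = measure p {u. Y (W u) \<in> B}"
      "P.prob (?a \<inter> ?b) = measure p {u. X (W u) \<in> A \<and> Y (W u) \<in> B}"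
      using ab W by (simp_all add: measure_atomic_law)
    have eq: "measure p E = measure p E'" if "\<And>u. u \<in> set_pmf p \<Longrightarrow> u \<in> E \<longleftrightarrow> u \<in> E'" for E E'
      using that by (intro measure_pmf.finite_measure_eq_AE AE_pmfI) auto
    show ?thesis
      using const
    proof
      assume c: "\<forall>u \<in> set_pmf p. X (W u) = c"
      have "measure p {u. X (W u) \<in> A} = measure p (if c \<in> A then UNIV else {})"
        by (rule eq) (use c in auto)
      moreover have "measure p {u. X (W u) \<in> A \<and> Y (W u) \<in> B} =
          measure p (if c \<in> A then {u. Y (W u) \<in> B} else {})"
        by (rule eq) (use c in auto)
      ultimately show ?thesis unfolding m by simp
    next
      assume d: "\<forall>u \<in> set_pmf p. Y (W u) = d"
      have "measure p {u. Y (W u) \<in> B} = measure p (if d \<in> B then UNIV else {})"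
        by (rule eq) (use d in auto)
      moreover have "measure p {u. X (W u) \<in> A \<and> Y (W u) \<in> B} =
          measure p (if d \<in> B then {u. X (W u) \<in> A} else {})"
        by (rule eq) (use d in auto)
      ultimately show ?thesis unfolding m by simp
    qed
  qed
  have "P.indep_set {X -` A \<inter> space F |A. A \<in> sets M} {Y -` A \<inter> space F |A. A \<in> sets N}"
  proof (rule P.indep_setI)
    show "{X -` A \<inter> space F |A. A \<in> sets M} \<subseteq> P.events"
      using measurable_sets[OF X] sets by auto
    show "{Y -` A \<inter> space F |A. A \<in> sets N} \<subseteq> P.events"
      using measurable_sets[OF Y] sets by auto
  qed (use prod in blast)
  then show ?thesis
    unfolding P.indep_var_eq space gen[OF X] gen[OF Y] using rv by blast
qed

section \<open>Laws separating two graphs that differ by an edge\<close>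

lemma not_admg_le_directed:
  assumes vw: "(w, v) \<in> directed G" "(w, v) \<notin> directed H" "w \<noteq> v"
  shows "\<not> admg_le S F G H"
proof -
  \<comment> \<open>Not intervening on \<open>w\<close> and imposing \<open>pt1 w\<close> have the
    same effect on \<open>v\<close>. Since the outcome of \<open>w\<close> is always
    \<open>pt1 w\<close>, even when \<open>w\<close> is intervened on, substituting that outcome
    where \<open>w\<close> was free changes nothing; this gives consistency, and exclusion for
    \<open>G\<close>.\<close>
  define f where "f u m = (if u = v \<and> m w \<notin> {None, Some (pt1 w)} then pt2 u else pt1 u)"
    for u and m :: "'v \<rightharpoonup> 'a"
  define W where "W = (\<lambda>_ :: unit. schedule_of f)"
  let ?P = "atomic_law (return_pmf ()) W"
  have W: "W u \<in> space F" for u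
    unfolding W_def by (intro schedule_of_space) (simp add: f_def pt1 pt2)
  have outcome: "outcome (W u) m = (\<lambda>v. f v m)" if "m \<in> interventions S" for u m
    unfolding W_def by (rule outcome_schedule_of[OF that])
  have imp: "impose x I \<in> interventions S" if "x \<in> states S" for x I
    using that by (auto simp: interventions_def)
  have imp_f: "impose x K ++ impose (\<lambda>v. f v m) J \<in> interventions S" if "x \<in> states S" for x K J m
    using that by (intro add_interventions imp) (auto simp: states_iff f_def pt1 pt2)
  have fw: "f w m = pt1 w" for m using vw(3) by (simp add: f_def)
  have f_cong: "f z m = f z m'"
    if "m w \<in> {None, Some (pt1 w)} \<longleftrightarrow> m' w \<in> {None, Some (pt1 w)}" for z m m'
    unfolding f_def by (simp only: that)
  have cons: "consistent_schedule (W u)" for u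
    unfolding consistent_schedule_def
  proof (intro ballI allI impI)
    fix x and I J :: "'v set" assume x: "x \<in> states S" and IJ: "I \<inter> J = {}"
    show "outcome (W u) (impose x I ++ impose (outcome (W u) (impose x I)) J) = outcome (W u) (impose x I)"
      unfolding outcome[OF imp[OF x]] outcome[OF imp_f[OF x]]
    proof
      fix z
      \<comment> \<open>If \<open>w\<close> is in \<open>I\<close>, it is not in \<open>J\<close>
        and keeps its imposed value; otherwise it stays free or receives
        \<open>pt1 w\<close>.\<close>
      have "(impose x I ++ impose (\<lambda>v. f v (impose x I)) J) w \<in> {None, Some (pt1 w)} \<longleftrightarrow>
          impose x I w \<in> {None, Some (pt1 w)}"
        using IJ fw by (auto simp: map_add_def impose_apply)
      then show "f z (impose x I ++ impose (\<lambda>v. f v (impose x I)) J) = f z (impose x I)"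
        by (rule f_cong)
    qed
  qed
  note model = atomic_law_admg_model_iff[OF W _ cons, of "return_pmf ()", simplified]
  have ind: "independence S G ?P"
    unfolding independence_def
    by (intro allI impI ballI indep_var_atomic_law[OF W]) (auto intro!: measurable_restrict_outcome imp)
  have exclG: "exclusion S G ?P"
    unfolding exclusion_atomic_law[OF W]
  proof (intro allI ballI)
    fix z I x u assume x: "x \<in> states S"
    let ?m = "impose x (parents G z \<inter> I) ++ impose (\<lambda>v. f v (impose x I)) (parents G z - I)"
    have "f z ?m = f z (impose x I)"
    proof (cases "z = v")
      case True
      then have "w \<in> parents G z" using vw by (simp add: parents_def)
      then have "?m w \<in> {None, Some (pt1 w)} \<longleftrightarrow> impose x I w \<in> {None, Some (pt1 w)}"
        using fw by (auto simp: map_add_def impose_apply)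
      then show ?thesis by (rule f_cong)
    qed (simp add: f_def)
    then show "outcome (W u) (impose x I) z =
        outcome (W u) (impose x (parents G z \<inter> I) ++ impose (outcome (W u) (impose x I)) (parents G z - I)) z"
      unfolding outcome[OF imp[OF x]] outcome[OF imp_f[OF x]] by simp
  qed
  have "\<not> exclusion S H ?P"
  proof
    assume "exclusion S H ?P"
    \<comment> \<open>Imposing \<open>pt2 w\<close> on \<open>w\<close> makes \<open>v\<close>
      react. Exclusion for \<open>H\<close> would drop this intervention, as \<open>w\<close> is no
      parent there, and \<open>v\<close> would return to \<open>pt1 v\<close>.\<close>
    moreover have x: "pt2 \<in> states S" by (simp add: states_iff pt2)
    ultimately have "outcome (W ()) (impose pt2 {w}) v =
        outcome (W ()) (impose pt2 (parents H v \<inter> {w}) ++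
          impose (outcome (W ()) (impose pt2 {w})) (parents H v - {w})) v"
      unfolding exclusion_atomic_law[OF W] by simp
    moreover have "w \<notin> parents H v" using vw by (simp add: parents_def)
    ultimately have "f v (impose pt2 {w}) =
        f v (impose pt2 (parents H v \<inter> {w}) ++ impose (\<lambda>v. f v (impose pt2 {w})) (parents H v - {w}))"
      unfolding outcome[OF imp[OF x]] outcome[OF imp_f[OF x]] by simp
    moreover have "f v (impose pt2 {w}) = pt2 v" by (simp add: f_def impose_apply pt2)
    moreover have "f v (impose pt2 (parents H v \<inter> {w}) ++ impose (\<lambda>v. f v (impose pt2 {w})) (parents H v - {w})) = pt1 v"
      using \<open>w \<notin> parents H v\<close> by (simp add: f_def map_add_def impose_apply)
    ultimately show False using pt2(2)[of v] by simp
  qed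
  then have "?P \<notin> admg_model S F H" unfolding model by simp
  moreover have "?P \<in> admg_model S F G" unfolding model using ind exclG by simp
  ultimately show ?thesis unfolding admg_le_def by blast
qed

lemma not_admg_le_bidirected:
  assumes vw: "{v, w} \<in> bidirected G" "{v, w} \<notin> bidirected H" "v \<noteq> w"
  shows "\<not> admg_le S F G H"
proof -
  define f where "f b u = (if b \<and> u \<in> {v, w} then pt2 u else pt1 u)" for b u
  \<comment> \<open>Outcomes ignore interventions, so consistency and exclusion hold at each atom
    for every graph; only independence is at stake.\<close>
  define W where "W = (\<lambda>b. schedule_of (\<lambda>u _. f b u))"
  \<comment> \<open>Any bias \<open>q\<close> strictly between 0 and 1 would do: all that matters is
    that \<open>q\<close> differs from its square.\<close>
  define p :: "bool pmf" where "p = bernoulli_pmf (1 / 2)"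
  let ?P = "atomic_law p W"
  have f: "f b u \<in> space (S u)" for b u by (simp add: f_def pt1 pt2)
  have W: "W u \<in> space F" for u
    unfolding W_def by (intro schedule_of_space f)
  have outcome: "outcome (W b) m = f b" if "m \<in> interventions S" for b m
    unfolding W_def by (simp add: outcome_schedule_of[OF that])
  have imp: "impose x I \<in> interventions S" if "x \<in> states S" for x I
    using that by (auto simp: interventions_def)
  have imp_f: "impose x K ++ impose (f b) J \<in> interventions S" if "x \<in> states S" for x K J b
    using that by (intro add_interventions imp) (auto simp: states_iff f)
  have cons: "consistent_schedule (W u)" for u
    unfolding consistent_schedule_def by (simp add: outcome imp imp_f)
  have fin: "finite (set_pmf p)" by simp
  note model = atomic_law_admg_model_iff[OF W fin cons]
  have excl: "exclusion S K ?P" for K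
    unfolding exclusion_atomic_law[OF W] by (simp add: outcome imp imp_f)
  have indG: "independence S G ?P"
    unfolding independence_def
  proof (intro allI impI ballI)
    fix A B x assume x: "x \<in> states S" and "A \<inter> B = {}"
      and "\<forall>a \<in> A. \<forall>b \<in> B. {a, b} \<notin> bidirected G"
    \<comment> \<open>If both sets met \<open>{v, w}\<close>, being disjoint they would contain one
      endpoint each, against the edge in \<open>G\<close>. So one of them sees only
      constants.\<close>
    then have "A \<inter> {v, w} = {} \<or> B \<inter> {v, w} = {}"
      using vw(1) by (auto simp: insert_commute)
    then have "(\<forall>b. restrict (f b) A = restrict pt1 A) \<or> (\<forall>b. restrict (f b) B = restrict pt1 B)"
      by (auto simp: f_def restrict_def fun_eq_iff)
    then have const: "(\<forall>b \<in> set_pmf p. restrict (outcome (W b) (impose x UNIV)) A = restrict pt1 A) \<or>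
        (\<forall>b \<in> set_pmf p. restrict (outcome (W b) (impose x UNIV)) B = restrict pt1 B)"
      unfolding outcome[OF imp[OF x]] by blast
    show "prob_space.indep_var ?P
        (Pi\<^sub>M A S) (\<lambda>\<omega>. restrict (outcome \<omega> (impose x UNIV)) A)
        (Pi\<^sub>M B S) (\<lambda>\<omega>. restrict (outcome \<omega> (impose x UNIV)) B)"
      by (rule indep_var_atomic_law[OF W _ _ const]) (intro measurable_restrict_outcome imp x)+
  qed
  have "\<not> independence S H ?P"
  proof
    assume ind: "independence S H ?P"
    interpret P: prob_space ?P
      using atomic_law_prob[OF W, of p] by (simp add: space_prob_algebra)
    have space: "space ?P = space F" by (simp add: atomic_law_def)
    have x: "pt1 \<in> states S" by (simp add: states_iff pt1)
    let ?X = "\<lambda>A \<omega>. restrict (outcome \<omega> (impose pt1 UNIV)) A"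
    let ?y = "\<lambda>A. restrict pt2 A"
    have indep: "P.indep_var (Pi\<^sub>M {v} S) (?X {v}) (Pi\<^sub>M {w} S) (?X {w})"
      using ind[unfolded independence_def, rule_format, of "{v}" "{w}" pt1] vw x by auto
    have y: "{?y A} \<in> sets (Pi\<^sub>M A S)" for A
      by (intro countably_separated_singleton countably_separated_PiM separated)
        (auto simp: space_PiM pt2)
    have prod: "P.prob ((\<lambda>\<omega>. (?X {v} \<omega>, ?X {w} \<omega>)) -` ({?y {v}} \<times> {?y {w}}) \<inter> space F) =
        P.prob (?X {v} -` {?y {v}} \<inter> space F) * P.prob (?X {w} -` {?y {w}} \<inter> space F)"
      unfolding space[symmetric] by (rule P.indep_varD[OF indep y y])
    have ev: "?X A -` {?y A} \<inter> space F \<in> sets F" for A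
      by (rule measurable_sets[OF measurable_restrict_outcome[OF imp[OF x]] y])
    have half: "measure p {b. b} = 1 / 2"
    proof -
      have "{b. b} = {True}" by auto
      then show ?thesis by (simp add: measure_pmf_single p_def)
    qed
    have ev_iff: "W b \<in> ?X {z} -` {?y {z}} \<inter> space F \<longleftrightarrow> b" if z: "z \<in> {v, w}" for z b
    proof -
      have "?X {z} (W b) = restrict (f b) {z}" unfolding outcome[OF imp[OF x]] ..
      moreover have "restrict (f b) {z} = ?y {z} \<longleftrightarrow> f b z = pt2 z"
        by (auto simp: fun_eq_iff restrict_def)
      moreover have "f b z = pt2 z \<longleftrightarrow> b"
        using z pt2(2)[of z] by (auto simp: f_def)
      ultimately show ?thesis using W by simp
    qed
    have 1: "P.prob (?X {z} -` {?y {z}} \<inter> space F) = 1 / 2" if "z \<in> {v, w}" for z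
      unfolding measure_atomic_law[OF W ev] ev_iff[OF that] by (rule half)
    have pair: "(\<lambda>\<omega>. (?X {v} \<omega>, ?X {w} \<omega>)) -` ({?y {v}} \<times> {?y {w}}) \<inter> space F =
        (?X {v} -` {?y {v}} \<inter> space F) \<inter> (?X {w} -` {?y {w}} \<inter> space F)" by auto
    \<comment> \<open>Both events say that the coin shows \<open>True\<close>, so they occur jointly
      with probability 1/2, while independence demands 1/4.\<close>
    have "P.prob ((?X {v} -` {?y {v}} \<inter> space F) \<inter> (?X {w} -` {?y {w}} \<inter> space F)) = 1 / 2"
    proof -
      have "{u. W u \<in> (?X {v} -` {?y {v}} \<inter> space F) \<inter> (?X {w} -` {?y {w}} \<inter> space F)} = {b. b}"
        unfolding Int_iff[of "W _"] using ev_iff[of v] ev_iff[of w] by simp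
      then show ?thesis unfolding measure_atomic_law[OF W sets.Int[OF ev ev]] using half by (simp only:)
    qed
    then show False
      using prod unfolding pair 1[OF insertI1] 1[OF insertI2[OF singletonI]] by linarith
  qed
  then have "?P \<notin> admg_model S F H" unfolding model by simp
  moreover have "?P \<in> admg_model S F G" unfolding model using indG excl by simp
  ultimately show ?thesis unfolding admg_le_def by blast
qed

text \<open>Membership in \<open>admgs\<close> ensures that an edge of \<open>G\<close> joins two
  distinct vertices, as the separating laws require; for directed edges, acyclicity excludes
  loops.\<close>

theorem admg_le_iff:
  assumes G: "G \<in> admgs"
  shows "admg_le S F G H \<longleftrightarrow> bidirected G \<subseteq> bidirected H \<and> directed G \<subseteq> directed H"
proof
  assume le: "admg_le S F G H"
  have "e \<in> bidirected H" if e: "e \<in> bidirected G" for e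
  proof -
    have "card e = 2" using e G by (auto simp: admgs_def)
    then obtain v w where "e = {v, w}" "v \<noteq> w" by (auto simp: card_2_iff)
    then show ?thesis using not_admg_le_bidirected le e by blast
  qed
  moreover have "(w, v) \<in> directed H" if e: "(w, v) \<in> directed G" for w v
  proof -
    have "w \<noteq> v" using e G by (auto simp: admgs_def acyclic_def)
    then show ?thesis using not_admg_le_directed le e by blast
  qed
  ultimately show "bidirected G \<subseteq> bidirected H \<and> directed G \<subseteq> directed H" by auto
qed (simp add: admg_le_mono)

end

section \<open>Graphs as finite edge sets, and the distance formula\<close>

definition edges :: "'v mixed_graph \<Rightarrow> ('v set + 'v \<times> 'v) set" where
  "edges G = bidirected G <+> directed G"

text \<open>The disjoint sum keeps apart the two edges that one pair of vertices may carry, so the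
  two counts add.\<close>

lemma card_sym_diff_edges:
  fixes G H :: "'v::finite mixed_graph"
  shows "card (sym_diff (edges G) (edges H)) =
    card (sym_diff (bidirected G) (bidirected H)) + card (sym_diff (directed G) (directed H))"
proof -
  have "sym_diff (edges G) (edges H) =
      sym_diff (bidirected G) (bidirected H) <+> sym_diff (directed G) (directed H)"
    unfolding edges_def by auto
  then show ?thesis by (simp add: card_Plus)
qed

lemma (in potential_outcomes) downset_poset_admgs:
  "downset_poset admgs (admg_le S F) edges"
proof
  fix G H :: "'v mixed_graph" assume G: "G \<in> admgs"
  show "finite (edges G)" by simp
  show "admg_le S F G H \<longleftrightarrow> edges G \<subseteq> edges H"
    unfolding admg_le_iff[OF G] edges_def by auto
next
  show "inj_on edges (admgs :: 'v mixed_graph set)"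
  proof (rule inj_onI)
    fix G H :: "'v mixed_graph" assume "edges G = edges H"
    then have "Inl -` edges G = Inl -` edges H" "Inr -` edges G = Inr -` edges H" by simp_all
    then have "bidirected G = bidirected H" "directed G = directed H"
      by (auto simp: edges_def vimage_def)
    then show "G = H" by (simp add: mixed_graph.expand)
  qed
next
  fix H :: "'v mixed_graph" and X assume H: "H \<in> admgs" and X: "X \<subseteq> edges H"
  define G where "G = Mixed_Graph (Inl -` X) (Inr -` X)"
  have "Inl -` X \<subseteq> bidirected H" "Inr -` X \<subseteq> directed H" using X by (auto simp: edges_def)
  then have "G \<in> admgs" using H acyclic_subset by (auto simp: admgs_def G_def)
  moreover have "edges G = X"
  proof (rule set_eqI)
    show "z \<in> edges G \<longleftrightarrow> z \<in> X" for z by (cases z) (auto simp: edges_def G_def)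
  qed
  ultimately show "\<exists>G \<in> admgs. edges G = X" by blast
qed

theorem corollary5:
  fixes S :: "'v::finite \<Rightarrow> 'a measure"
    and F :: "('v, 'a) schedule measure"
    and G\<^sub>1 G\<^sub>2 :: "'v mixed_graph"
  assumes "\<And>v. state_space (S v)"
    and "schedule_space S F"
    and "G\<^sub>1 \<in> admgs" and "G\<^sub>2 \<in> admgs"
  shows "cover_dist admgs (admg_le S F) G\<^sub>1 G\<^sub>2 =
    enat (card (sym_diff (bidirected G\<^sub>1) (bidirected G\<^sub>2)) +
          card (sym_diff (directed G\<^sub>1) (directed G\<^sub>2)))"
proof -
  interpret potential_outcomes S F
    using assms(1,2) by unfold_locales
  show ?thesis
    using downset_poset.cover_dist_eq[OF downset_poset_admgs assms(3,4)]
    by (simp add: card_sym_diff_edges)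
qed

end
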